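(* The Lie algebras $\mathcal N_{r,0}$ and $\mathcal N_{0,r}$ are isomorphic for $r=1,2,4,8$.
   Context: $\mathbb R^{r,s}$ denotes $\mathbb R^{r+s}$ with the symmetric bilinear form $\langle x,y\rangle_{r,s}=\sum_{i=1}^r x_iy_i-\sum_{j=1}^s x_{r+j}y_{r+j}$, and $\mathrm{Cl}_{r,s}$ is the Clifford algebra it generates with the convention $x\otimes x=-\langle x,x\rangle_{r,s}$. A $\mathrm{Cl}_{r,s}$-module is a finite-dimensional real vector space $U$ with a linear map $J\colon\mathbb R^{r,s}\to\mathrm{End}(U)$ such that $J_z^2=-\langle z,z\rangle_{r,s}\mathrm{Id}_U$. It is admissible if equipped with a non-degenerate symmetric bilinear form $\langle\cdot,\cdot\rangle_U$ with $\langle J_zx,y\rangle_U+\langle x,J_zy\rangle_U=0$ for all $z,x,y$; minimal admissible (denoted $V^{r,s}$) means (nonzero) admissible of the smallest possible dimension. $\mathcal N_{r,s}(U)=U\oplus\mathbb R^{r,s}$ is the 2-step nilpotent Lie algebra with centre $\mathbb R^{r,s}$ and bracket $[U,U]\subset\mathbb R^{r,s}$ given by $\langle J_zx,y\rangle_U=\langle z,[x,y]\rangle_{r,s}$. One writes $\mathcal N_{r,s}=\mathcal N_{r,s}(V^{r,s})$; up to isomorphism this does not depend on the choice of the minimal admissible module. *)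

theory Defs
  imports "HOL-Analysis.Analysis"
begin

text \<open>
  The space \<open>\<real>\<^sup>r\<^sup>,\<^sup>s\<close> is modelled as \<^typ>\<open>real ^ 'n\<close> together with a set \<open>P\<close> of coordinates on which
  the form is positive, where \<open>card P = r\<close> and \<open>card (- P) = s\<close>; so \<open>P\<close> plays the role of
  \<open>{1..r}\<close> and \<open>- P\<close> that of \<open>{r + 1..r + s}\<close>.  This allows \<open>r = 0\<close> or \<open>s = 0\<close>.
\<close>

definition pseudo_inner :: "'n::finite set \<Rightarrow> real ^ 'n \<Rightarrow> real ^ 'n \<Rightarrow> real" where
  "pseudo_inner P x y = (\<Sum>i\<in>P. x $ i * y $ i) - (\<Sum>j\<in>- P. x $ j * y $ j)"

text \<open>
  A finite-dimensional real vector space is a finitely generated subspace \<open>U\<close> of an arbitrary real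
  vector space.  Linear and bilinear maps defined on \<open>U\<close> are represented by linear and bilinear
  maps on the ambient type, of which only the values on \<open>U\<close> matter.  As every linear or bilinear
  map extends from a subspace to the whole space, nothing is lost by this.
\<close>

definition clifford_module ::
  "'n::finite set \<Rightarrow> 'u::real_vector set \<Rightarrow> (real ^ 'n \<Rightarrow> 'u \<Rightarrow> 'u) \<Rightarrow> bool" where
  "clifford_module P U J \<longleftrightarrow>
     (\<exists>F. finite F \<and> U = span F) \<and>
     bilinear J \<and>
     (\<forall>z. \<forall>x\<in>U. J z x \<in> U) \<and>
     (\<forall>z. \<forall>x\<in>U. J z (J z x) = - pseudo_inner P z z *\<^sub>R x)"

definition admissible_module ::
  "'n::finite set \<Rightarrow> 'u::real_vector set \<Rightarrow> (real ^ 'n \<Rightarrow> 'u \<Rightarrow> 'u) \<Rightarrow> ('u \<Rightarrow> 'u \<Rightarrow> real) \<Rightarrow> bool"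
where
  "admissible_module P U J B \<longleftrightarrow>
     clifford_module P U J \<and>
     bilinear B \<and>
     (\<forall>x\<in>U. \<forall>y\<in>U. B x y = B y x) \<and>
     (\<forall>x\<in>U. (\<forall>y\<in>U. B x y = 0) \<longrightarrow> x = 0) \<and>
     (\<forall>z. \<forall>x\<in>U. \<forall>y\<in>U. B (J z x) y + B x (J z y) = 0)"

text \<open>
  The competitors \<open>U'\<close> range over subspaces of the same ambient type.  This is no restriction, by
  lemma \<open>minimal_admissible_module_dim_le\<close> below.
\<close>

definition minimal_admissible_module ::
  "'n::finite set \<Rightarrow> 'u::real_vector set \<Rightarrow> (real ^ 'n \<Rightarrow> 'u \<Rightarrow> 'u) \<Rightarrow> ('u \<Rightarrow> 'u \<Rightarrow> real) \<Rightarrow> bool"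
where
  "minimal_admissible_module P U J B \<longleftrightarrow>
     admissible_module P U J B \<and> U \<noteq> {0} \<and>
     (\<forall>(U' :: 'u set) J' B'. admissible_module P U' J' B' \<and> U' \<noteq> {0} \<longrightarrow> dim U \<le> dim U')"

lemma minimal_admissible_module_dim_le:
  fixes U :: "'u::real_vector set" and U' :: "'v::real_vector set"
  assumes min: "minimal_admissible_module P U J B"
    and adm: "admissible_module P U' J' B'" and nz: "U' \<noteq> {0}"
  shows "dim U \<le> dim U'"
proof (rule ccontr)
  assume "\<not> dim U \<le> dim U'"
  then have less: "dim U' < dim U" by simp
  obtain F where F: "finite F" "U' = span F"
    using adm unfolding admissible_module_def clifford_module_def by auto
  have sU': "subspace U'" using F by simp
  obtain C where C: "C \<subseteq> U'" "independent C" "U' \<subseteq> span C" "card C = dim U'"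
    using basis_exists by blast
  have finC: "finite C"
    using independent_span_bound[OF F(1) C(2)] C(1) F(2) by auto
  have spC: "span C = U'" using C sU' by (simp add: span_minimal subset_antisym)
  obtain D0 where D0: "D0 \<subseteq> U" "independent D0" "U \<subseteq> span D0" "card D0 = dim U"
    using basis_exists by blast
  obtain D where D: "D \<subseteq> D0" "card D = card C" "finite D"
    using obtain_subset_with_card_n[of "card C" D0] less C(4) D0(4) by auto
  have indD: "independent D" using D0(2) D(1) independent_mono by blast
  obtain k where k: "bij_betw k D C"
    using finite_same_card_bij[OF D(3) finC] D(2) by auto
  obtain g where g: "linear g" "\<And>x. x \<in> D \<Longrightarrow> g x = k x"
    using linear_independent_extend[OF indD, of k] by auto
  obtain h where h: "linear h" "\<And>y. y \<in> C \<Longrightarrow> h y = the_inv_into D k y"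
    using linear_independent_extend[OF C(2), of "the_inv_into D k"] by auto
  define S where "S = span D"
  have gS: "g ` S = U'"
  proof -
    have "g ` D = C" using g(2) k by (auto simp: bij_betw_def image_iff)
    then show ?thesis using linear_span_image[OF g(1), of D] spC by (simp add: S_def)
  qed
  have hg: "h (g x) = x" if "x \<in> S" for x
  proof -
    have "subspace {x. h (g x) = x}"
      using g(1) h(1) by (auto simp: subspace_def linear_iff linear_0)
    moreover have "D \<subseteq> {x. h (g x) = x}"
      using g(2) h(2) k by (auto simp: bij_betw_def the_inv_into_f_f)
    ultimately show ?thesis using that span_minimal unfolding S_def by blast
  qed
  have gU: "g x \<in> U'" if "x \<in> S" for x using gS that by auto
  have gh: "g (h y) = y" if "y \<in> U'" for y using gS hg that by auto
  have hS: "h y \<in> S" if "y \<in> U'" for y using gS hg that by auto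
  have sS: "\<exists>F. finite F \<and> S = span F" using D(3) by (auto simp: S_def)
  have dimS: "dim S = dim U'"
    using indD D(2) C(4) by (simp add: S_def dim_eq_card_independent)
  note A = adm[unfolded admissible_module_def clifford_module_def]
  have bJ: "bilinear J'" and bB: "bilinear B'" using A by auto
  have JU: "J' z x \<in> U'" if "x \<in> U'" for z x using A that by auto
  have "bilinear (\<lambda>z x. h (J' z (g x)))"
    using bJ g(1) h(1) unfolding bilinear_def linear_iff by auto
  moreover have "bilinear (\<lambda>x y. B' (g x) (g y))"
    using bB g(1) unfolding bilinear_def linear_iff by auto
  moreover have "h (J' z (g x)) \<in> S" if "x \<in> S" for z x
    using that gU JU hS by auto
  moreover have "h (J' z (g (h (J' z (g x))))) = - pseudo_inner P z z *\<^sub>R x" if "x \<in> S" for z x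
  proof -
    have "J' z (J' z (g x)) = - pseudo_inner P z z *\<^sub>R g x" using A gU[OF that] by auto
    then show ?thesis
      using gU[OF that] JU gh hg[OF that] linear_cmul[OF h(1)] linear_neg[OF h(1)] by simp
  qed
  moreover have "B' (g x) (g y) = B' (g y) (g x)" if "x \<in> S" "y \<in> S" for x y
    using A gU that by auto
  moreover have "x = 0" if x: "x \<in> S" and 0: "\<forall>y\<in>S. B' (g x) (g y) = 0" for x
  proof -
    have "\<forall>y\<in>U'. B' (g x) y = 0" using 0 gS by auto
    then have "g x = 0" using A gU[OF x] by auto
    then show ?thesis using hg[OF x] linear_0[OF h(1)] by simp
  qed
  moreover have "B' (g (h (J' z (g x)))) (g y) + B' (g x) (g (h (J' z (g y)))) = 0"
    if "x \<in> S" "y \<in> S" for z x y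
    using A gU that JU gh by auto
  ultimately have "admissible_module P S (\<lambda>z x. h (J' z (g x))) (\<lambda>x y. B' (g x) (g y))"
    unfolding admissible_module_def clifford_module_def using sS by blast
  moreover have "S \<noteq> {0}"
  proof
    assume "S = {0}"
    then have "U' = {0}" using gS linear_0[OF g(1)] by auto
    with nz show False by simp
  qed
  ultimately have "dim U \<le> dim S" using min unfolding minimal_admissible_module_def by blast
  then show False using dimS less by simp
qed

text \<open>
  The description in \<open>nr_bracket\<close> determines the centre component uniquely, see lemma
  \<open>nr_bracket_eq_iff\<close> below.
\<close>

definition nr_bracket ::
  "'n::finite set \<Rightarrow> (real ^ 'n \<Rightarrow> 'u::real_vector \<Rightarrow> 'u) \<Rightarrow> ('u \<Rightarrow> 'u \<Rightarrow> real) \<Rightarrow>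
   'u \<times> (real ^ 'n) \<Rightarrow> 'u \<times> (real ^ 'n) \<Rightarrow> 'u \<times> (real ^ 'n)" where
  "nr_bracket P J B v w =
     (0, THE c. \<forall>z. B (J z (fst v)) (fst w) = pseudo_inner P z c)"

definition nr_carrier :: "'u set \<Rightarrow> ('u \<times> (real ^ 'n)) set" where
  "nr_carrier U = U \<times> UNIV"

definition lie_algebra_on :: "'a::real_vector set \<Rightarrow> ('a \<Rightarrow> 'a \<Rightarrow> 'a) \<Rightarrow> bool" where
  "lie_algebra_on L br \<longleftrightarrow>
     subspace L \<and>
     (\<forall>x\<in>L. \<forall>y\<in>L. br x y \<in> L) \<and>
     (\<forall>x\<in>L. \<forall>y\<in>L. \<forall>z\<in>L. br (x + y) z = br x z + br y z \<and> br z (x + y) = br z x + br z y) \<and>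
     (\<forall>c. \<forall>x\<in>L. \<forall>y\<in>L. br (c *\<^sub>R x) y = c *\<^sub>R br x y \<and> br x (c *\<^sub>R y) = c *\<^sub>R br x y) \<and>
     (\<forall>x\<in>L. br x x = 0) \<and>
     (\<forall>x\<in>L. \<forall>y\<in>L. \<forall>z\<in>L. br x (br y z) + br y (br z x) + br z (br x y) = 0)"

text \<open>
  As above, an isomorphism \<open>L \<rightarrow> L'\<close> is represented by a linear map on the ambient type.
\<close>

definition lie_algebra_isomorphic ::
  "'a::real_vector set \<Rightarrow> ('a \<Rightarrow> 'a \<Rightarrow> 'a) \<Rightarrow> 'b::real_vector set \<Rightarrow> ('b \<Rightarrow> 'b \<Rightarrow> 'b) \<Rightarrow> bool" where
  "lie_algebra_isomorphic L br L' br' \<longleftrightarrow>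
     (\<exists>f. linear f \<and> bij_betw f L L' \<and> (\<forall>x\<in>L. \<forall>y\<in>L. f (br x y) = br' (f x) (f y)))"

lemma pseudo_inner_sum:
  "pseudo_inner P x y = (\<Sum>i\<in>UNIV. (if i \<in> P then 1 else - 1) * (x $ i * y $ i))"
proof -
  have "(\<Sum>i\<in>UNIV. (if i \<in> P then 1 else - 1) * (x $ i * y $ i)) =
        (\<Sum>i\<in>P. (if i \<in> P then 1 else - 1) * (x $ i * y $ i)) +
        (\<Sum>i\<in>- P. (if i \<in> P then 1 else - 1) * (x $ i * y $ i))"
    by (subst sum.union_disjoint[symmetric]) (auto simp: Compl_partition)
  also have "\<dots> = pseudo_inner P x y"
    by (simp add: pseudo_inner_def flip: sum_negf)
  finally show ?thesis by simp
qed

lemma pseudo_inner_represents: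
  assumes "linear f"
  shows "(\<forall>z. f z = pseudo_inner P z c) \<longleftrightarrow> c = (\<chi> i. (if i \<in> P then 1 else - 1) * f (axis i 1))"
    (is "_ \<longleftrightarrow> c = ?w")
proof
  assume l: "\<forall>z. f z = pseudo_inner P z c"
  have "(if i \<in> P then 1 else - 1) * f (axis i 1) = c $ i" for i
  proof -
    have "f (axis i 1) = (if i \<in> P then 1 else - 1) * c $ i"
      unfolding l[rule_format] pseudo_inner_sum axis_def
      by (simp add: if_distrib[where f = "\<lambda>t. t * _"] if_distrib[where f = "\<lambda>t. _ * t"]
          sum.delta cong: if_cong)
    then show ?thesis by simp
  qed
  then show "c = ?w" by (simp add: vec_eq_iff)
next
  assume c: "c = ?w"
  show "\<forall>z. f z = pseudo_inner P z c"
  proof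
    fix z :: "real ^ 'a"
    have "f z = f (\<Sum>i\<in>UNIV. z $ i *\<^sub>R axis i 1)"
      using basis_expansion[of z] by (simp add: scalar_mult_eq_scaleR)
    also have "\<dots> = (\<Sum>i\<in>UNIV. z $ i * f (axis i 1))"
      using assms by (simp add: linear_sum linear_cmul)
    also have "\<dots> = pseudo_inner P z c"
      unfolding pseudo_inner_sum c by (rule sum.cong) auto
    finally show "f z = pseudo_inner P z c" .
  qed
qed

lemma nr_bracket_eq_iff:
  assumes "bilinear J" "bilinear B"
  shows "nr_bracket P J B (x, a) (y, b) = (u, c) \<longleftrightarrow>
         u = 0 \<and> (\<forall>z. B (J z x) y = pseudo_inner P z c)"
proof -
  have lin: "linear (\<lambda>z. B (J z x) y)"
    using assms unfolding bilinear_def linear_iff by auto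
  show ?thesis
    unfolding nr_bracket_def by (auto simp: pseudo_inner_represents[OF lin])
qed

lemma nr_bracket_expand:
  assumes "bilinear J" "bilinear B"
  shows "nr_bracket P J B v w =
         (0, \<chi> i. (if i \<in> P then 1 else - 1) * B (J (axis i 1) (fst v)) (fst w))"
proof -
  have "linear (\<lambda>z. B (J z (fst v)) (fst w))"
    using assms unfolding bilinear_def linear_iff by auto
  then show ?thesis by (simp add: nr_bracket_def pseudo_inner_represents)
qed

lemma nr_lie_algebra:
  fixes P :: "'n::finite set" and U :: "'u::real_vector set"
  assumes "admissible_module P U J B"
  shows "lie_algebra_on (nr_carrier U) (nr_bracket P J B)"
proof -
  note A = assms[unfolded admissible_module_def clifford_module_def]
  have bJ: "bilinear J" and bB: "bilinear B" using A by auto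
  have sU: "subspace U" using A by (metis subspace_span)
  have alt: "B (J z x) x = 0" if "x \<in> U" for z x
  proof -
    have "J z x \<in> U" "B (J z x) x + B x (J z x) = 0"
      using A that by blast+
    moreover have "B (J z x) x = B x (J z x)"
      using A that \<open>J z x \<in> U\<close> by blast
    ultimately show ?thesis by simp
  qed
  have "subspace (nr_carrier U :: ('u \<times> (real ^ 'n)) set)"
    unfolding nr_carrier_def by (intro subspace_Times sU subspace_UNIV)
  then show ?thesis
    unfolding lie_algebra_on_def nr_bracket_expand[OF bJ bB]
    using subspace_0[OF sU] alt
    by (auto simp: nr_carrier_def vec_eq_iff algebra_simps zero_prod_def
        bilinear_ladd[OF bB] bilinear_radd[OF bB] bilinear_lmul[OF bB] bilinear_rmul[OF bB]
        bilinear_radd[OF bJ] bilinear_rmul[OF bJ] bilinear_lzero[OF bB] bilinear_rzero[OF bB]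
        bilinear_rzero[OF bJ])
qed

end

theory Submission
  imports Defs
begin

text \<open>
  Write \<open>J\<^sub>0, \<dots>, J\<^sub>r\<^sub>-\<^sub>1\<close> for the Clifford action of an orthonormal basis, so that \<open>J\<^sub>i\<^sup>2 = - \<epsilon>\<close> with
  \<open>\<epsilon> = 1\<close> for \<open>\<real>\<^sup>r\<^sup>,\<^sup>0\<close> and \<open>\<epsilon> = - 1\<close> for \<open>\<real>\<^sup>0\<^sup>,\<^sup>r\<close>. The products \<open>J\<^sub>a J\<^sub>b J\<^sub>c J\<^sub>d\<close> along
  suitable quadruples are commuting symmetric involutions, for either sign of \<open>\<epsilon>\<close>. A common fixed
  vector \<open>x\<close> that is not null satisfies \<open>J\<^sub>i J\<^sub>j x = - J\<^sub>0 J\<^sub>l x\<close> for all oriented lines \<open>(i, j, l)\<close> of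
  the Fano plane. Hence the vectors \<open>J\<^sub>i x\<close> and \<open>J\<^sub>i J\<^sub>0 x\<close> form an orthogonal basis of an admissible
  submodule, which is the whole module by minimality. In the numbers \<open>\<langle>J\<^sub>i J\<^sub>j x, J\<^sub>k J\<^sub>0 x\<rangle> / \<langle>x, x\<rangle>\<close>,
  which are the structure constants of the Lie algebra, only \<open>\<epsilon>\<^sup>2 = 1\<close> occurs. So matching the two
  bases, with a scaling of the centre, is an isomorphism between the two signatures.
\<close>

section \<open>Fano plane combinatorics and the structure constants\<close>

text \<open>
  The index 0 stands for the octonion unit. The orientations come from declaring the quadruples
  0123, 0145, 0167 and 0246 to fix \<open>x\<close>, see \<open>fano_vector_eight\<close>. For \<open>r = 4\<close> only the first line has all
  its points below \<open>r\<close>, for \<open>r \<le> 2\<close> there is none.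
\<close>

definition fano_lines :: "(nat \<times> nat \<times> nat) set" where
  "fano_lines = {(1,2,3), (1,4,5), (1,6,7), (2,4,6), (2,7,5), (3,7,4), (3,6,5)}"

definition fano :: "(nat \<times> nat \<times> nat) set" where
  "fano = (\<Union>(a, b, c)\<in>fano_lines. {(a, b, c), (b, c, a), (c, a, b)})"

text \<open>\<open>pair_rel i j l s\<close> encodes \<open>J\<^sub>i J\<^sub>j x = s J\<^sub>0 J\<^sub>l x\<close>.\<close>

definition pair_rel :: "nat \<Rightarrow> nat \<Rightarrow> nat \<Rightarrow> real \<Rightarrow> bool" where
  "pair_rel i j l s \<longleftrightarrow>
     i = j \<and> l = 0 \<and> s = 1 \<or> i = 0 \<and> l = j \<and> s = 1 \<or> i \<noteq> 0 \<and> j = 0 \<and> l = i \<and> s = - 1 \<or>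
     (i, j, l) \<in> fano \<and> s = - 1 \<or> (j, i, l) \<in> fano \<and> s = 1"

text \<open>Two distinct points of the Fano plane lie on a line, found here by enumeration. The
  clause on indices below 4 serves \<open>r = 4\<close>: the points 1, 2, 3 form a line, so the
  third point stays below \<open>r\<close>. For \<open>r \<le> 2\<close> two distinct nonzero
  indices do not occur.\<close>

lemma pair_rel_ex:
  assumes "r \<in> {1, 2, 4, 8}" "i < r" "j < r"
  shows "\<exists>l<r. \<exists>s. pair_rel i j l s"
proof -
  have *: "\<exists>l<r. (i, j, l) \<in> fano \<or> (j, i, l) \<in> fano" if "i \<noteq> j" "i \<noteq> 0" "j \<noteq> 0"
  proof -
    have S: "{1..<8} = {1,2,3,4,5,6,7::nat}" by (simp add: atLeastLessThan_nat_numeral) blast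
    have "\<forall>i\<in>{1..<8}. \<forall>j\<in>{1..<8}. i \<noteq> j \<longrightarrow>
        (\<exists>l\<in>{1..<8}. ((i, j, l) \<in> fano \<or> (j, i, l) \<in> fano) \<and> (i < 4 \<and> j < 4 \<longrightarrow> l < 4))"
      unfolding S by (simp add: fano_def fano_lines_def)
    moreover have "i \<in> {1..<8}" "j \<in> {1..<8}" using assms that by auto
    ultimately obtain l where "l < 8" "(i, j, l) \<in> fano \<or> (j, i, l) \<in> fano" "i < 4 \<and> j < 4 \<longrightarrow> l < 4"
      using \<open>i \<noteq> j\<close> by (meson atLeastLessThan_iff)
    moreover have "r = 4 \<or> r = 8" using assms that by auto
    ultimately show ?thesis using assms by blast
  qed
  consider "i = j" | "i = 0" | "i \<noteq> 0" "j = 0" | l where "l < r" "(i, j, l) \<in> fano"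
    | l where "l < r" "(j, i, l) \<in> fano"
    using * by blast
  then show ?thesis
    using assms unfolding pair_rel_def by cases (auto intro: exI[of _ 0])
qed

lemma fano_distinct: "(i, j, l) \<in> fano \<Longrightarrow> i \<noteq> j"
  unfolding fano_def fano_lines_def by auto

text \<open>The sign in \<open>J\<^sub>i J\<^sub>j x = line_sign l s J\<^sub>l J\<^sub>0 x\<close>, with \<open>J\<^sub>0\<close> moved next to \<open>x\<close>.\<close>

definition line_sign :: "nat \<Rightarrow> real \<Rightarrow> real" where
  "line_sign l s = (if l = 0 then s else - s)"

text \<open>The pair is chosen by \<open>SOME\<close> from \<open>pair_rel\<close> alone, without
  reference to a module, so both signatures share literally the same constants.\<close>

definition trilinear_coeff :: "nat \<Rightarrow> nat \<Rightarrow> nat \<Rightarrow> nat \<Rightarrow> real" where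
  "trilinear_coeff r i j k =
     (case SOME (l, s). l < r \<and> pair_rel i j l s of (l, s) \<Rightarrow> if l = k then line_sign l s else 0)"

text \<open>The pairs \<open>(j, False)\<close> and \<open>(j, True)\<close> index the basis vectors \<open>J\<^sub>j x\<close> and \<open>J\<^sub>j J\<^sub>0 x\<close>.\<close>

fun structure_coeff :: "nat \<Rightarrow> nat \<Rightarrow> nat \<times> bool \<Rightarrow> nat \<times> bool \<Rightarrow> real" where
  "structure_coeff r i (j, False) (k, True) = trilinear_coeff r i j k"
| "structure_coeff r i (j, True) (k, False) = - trilinear_coeff r i k j"
| "structure_coeff r i (j, False) (k, False) = 0"
| "structure_coeff r i (j, True) (k, True) = 0"

section \<open>Orthogonal families and dimension\<close>

text \<open>The formula for orthogonal projection works for an indefinite form as long as no member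
  of the family is null. That the map kills everything orthogonal to the family yields nondegeneracy
  on the span in \<open>nondegenerate_span_frame\<close>.\<close>

lemma orthogonal_extend:
  fixes b :: "'i \<Rightarrow> 'u::real_vector" and b' :: "'i \<Rightarrow> 'w::real_vector"
    and B :: "'u \<Rightarrow> 'u \<Rightarrow> real"
  assumes "finite I" "bilinear B"
    and orth: "\<And>p q. p \<in> I \<Longrightarrow> q \<in> I \<Longrightarrow> p \<noteq> q \<Longrightarrow> B (b p) (b q) = 0"
    and norm: "\<And>p. p \<in> I \<Longrightarrow> B (b p) (b p) \<noteq> 0"
  obtains f where "linear f" "\<And>p. p \<in> I \<Longrightarrow> f (b p) = b' p"
    "\<And>u. (\<And>p. p \<in> I \<Longrightarrow> B u (b p) = 0) \<Longrightarrow> f u = 0"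
proof -
  define f where "f u = (\<Sum>q\<in>I. (B u (b q) / B (b q) (b q)) *\<^sub>R b' q)" for u
  have "linear f"
    unfolding f_def
    by (intro linearI) (simp_all add: bilinear_ladd[OF assms(2)] bilinear_lmul[OF assms(2)]
        add_divide_distrib scaleR_add_left sum.distrib scaleR_sum_right)
  moreover have "f (b p) = b' p" if p: "p \<in> I" for p
  proof -
    have "f (b p) = (\<Sum>q\<in>I. if q = p then b' p else 0)"
      unfolding f_def using orth[OF p] norm[OF p] by (intro sum.cong) auto
    then show ?thesis using p \<open>finite I\<close> by simp
  qed
  moreover have "f u = 0" if "\<And>p. p \<in> I \<Longrightarrow> B u (b p) = 0" for u
    using that by (simp add: f_def)
  ultimately show ?thesis using that by blast
qed

text \<open>The extensions in the two directions are mutually inverse on the spans, since they are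
  so on the families.\<close>

lemma orthogonal_bij:
  fixes b :: "'i \<Rightarrow> 'u::real_vector" and b' :: "'i \<Rightarrow> 'w::real_vector"
    and B :: "'u \<Rightarrow> 'u \<Rightarrow> real" and C :: "'w \<Rightarrow> 'w \<Rightarrow> real"
  assumes "finite I"
    and "bilinear B" "\<And>p q. p \<in> I \<Longrightarrow> q \<in> I \<Longrightarrow> p \<noteq> q \<Longrightarrow> B (b p) (b q) = 0"
      "\<And>p. p \<in> I \<Longrightarrow> B (b p) (b p) \<noteq> 0"
    and "bilinear C" "\<And>p q. p \<in> I \<Longrightarrow> q \<in> I \<Longrightarrow> p \<noteq> q \<Longrightarrow> C (b' p) (b' q) = 0"
      "\<And>p. p \<in> I \<Longrightarrow> C (b' p) (b' p) \<noteq> 0"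
  obtains f where "linear f" "\<And>p. p \<in> I \<Longrightarrow> f (b p) = b' p"
    "bij_betw f (span (b ` I)) (span (b' ` I))"
proof -
  obtain f where f: "linear f" "\<And>p. p \<in> I \<Longrightarrow> f (b p) = b' p"
    using orthogonal_extend[OF assms(1,2), where b = b and b' = b'] assms(3,4) by metis
  obtain g where g: "linear g" "\<And>p. p \<in> I \<Longrightarrow> g (b' p) = b p"
    using orthogonal_extend[OF assms(1,5), where b = b' and b' = b] assms(6,7) by metis
  have gf: "g (f u) = u" if "u \<in> span (b ` I)" for u
  proof -
    have "(g \<circ> f) u = id u"
      by (rule linear_eq_on[OF linear_compose[OF f(1) g(1)] linear_id that]) (auto simp: f g)
    then show ?thesis by simp
  qed
  have fg: "f (g w) = w" if "w \<in> span (b' ` I)" for w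
  proof -
    have "(f \<circ> g) w = id w"
      by (rule linear_eq_on[OF linear_compose[OF g(1) f(1)] linear_id that]) (auto simp: f g)
    then show ?thesis by simp
  qed
  have "f ` b ` I = b' ` I" "g ` b' ` I = b ` I" using f(2) g(2) by (auto simp: image_image)
  then have "f ` span (b ` I) = span (b' ` I)" "g ` span (b' ` I) = span (b ` I)"
    using linear_span_image[OF f(1), of "b ` I"] linear_span_image[OF g(1), of "b' ` I"] by auto
  then have "bij_betw f (span (b ` I)) (span (b' ` I))"
    using gf fg by (intro bij_betw_byWitness[where f' = g]) auto
  then show ?thesis using that f by blast
qed

lemma subspace_eq_if_dim_le:
  fixes S T :: "'a::real_vector set"
  assumes "subspace S" "S \<subseteq> T" "T = span F" "finite F" "dim T \<le> dim S"
  shows "S = T"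
proof (rule ccontr)
  assume "S \<noteq> T"
  then obtain u where u: "u \<in> T" "u \<notin> S" using assms(2) by auto
  obtain D where D: "D \<subseteq> S" "independent D" "S \<subseteq> span D" "card D = dim S"
    using basis_exists by blast
  obtain E where E: "E \<subseteq> T" "independent E" "T \<subseteq> span E" "card E = dim T"
    using basis_exists by blast
  have "finite E" using independent_span_bound[OF assms(4) E(2)] E(1) assms(3) by auto
  have "span D \<subseteq> S" using D(1) assms(1) by (rule span_minimal)
  then have "u \<notin> span D" using u by auto
  then have "independent (insert u D)" using D(2) by (simp add: independent_insertI)
  moreover have "insert u D \<subseteq> span E" using u D(1) E(3) assms(2) by auto
  ultimately have "finite (insert u D)" "card (insert u D) \<le> card E"
    using independent_span_bound[OF \<open>finite E\<close>, of "insert u D"] by auto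
  moreover have "u \<notin> D" using u D(1) by auto
  ultimately show False using D(4) E(4) assms(5) by simp
qed

section \<open>Clifford systems and common fixed vectors of the involutions\<close>

text \<open>Only the generators enter, numbered by naturals, and \<epsilon> carries the sign of the
  form, so that one set of axioms covers both signatures.\<close>

locale clifford_system =
  fixes U :: "'u::real_vector set" and B :: "'u \<Rightarrow> 'u \<Rightarrow> real" and J :: "nat \<Rightarrow> 'u \<Rightarrow> 'u"
    and r :: nat and \<epsilon> :: real
  assumes sub: "subspace U"
    and lin: "linear (J i)"
    and J_in: "i < r \<Longrightarrow> u \<in> U \<Longrightarrow> J i u \<in> U"
    and sq: "i < r \<Longrightarrow> u \<in> U \<Longrightarrow> J i (J i u) = - \<epsilon> *\<^sub>R u"
    and anti: "i < r \<Longrightarrow> j < r \<Longrightarrow> i \<noteq> j \<Longrightarrow> u \<in> U \<Longrightarrow> J i (J j u) = - J j (J i u)"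
    and bil: "bilinear B"
    and sym: "u \<in> U \<Longrightarrow> v \<in> U \<Longrightarrow> B u v = B v u"
    and skew: "i < r \<Longrightarrow> u \<in> U \<Longrightarrow> v \<in> U \<Longrightarrow> B (J i u) v = - B u (J i v)"
    and eps: "\<epsilon> = 1 \<or> \<epsilon> = - 1"
    and r: "r \<in> {1, 2, 4, 8}"
begin

lemmas J_lin = linear_neg[OF lin] linear_cmul[OF lin] linear_add[OF lin] linear_diff[OF lin]
lemmas B_lin = bilinear_ladd[OF bil] bilinear_radd[OF bil] bilinear_lmul[OF bil]
  bilinear_rmul[OF bil] bilinear_lneg[OF bil] bilinear_rneg[OF bil] bilinear_lsub[OF bil]
  bilinear_rsub[OF bil]
lemmas U_in = J_in subspace_neg[OF sub] subspace_scale[OF sub] subspace_add[OF sub]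
  subspace_diff[OF sub]

lemma anti_sort: "j < i \<Longrightarrow> i < r \<Longrightarrow> u \<in> U \<Longrightarrow> J i (J j u) = - J j (J i u)"
  by (intro anti) auto

lemma r_pos: "0 < r"
  using r by auto

lemma eps_mult [simp]: "\<epsilon> * \<epsilon> = 1" "\<epsilon> * (\<epsilon> * t) = t"
  using eps by auto

lemma B_J_self:
  assumes "i < r" "u \<in> U"
  shows "B (J i u) u = 0"
proof -
  have "B (J i u) u = - B u (J i u)" using assms skew by simp
  moreover have "B u (J i u) = B (J i u) u" using assms sym J_in by simp
  ultimately show ?thesis by linarith
qed

lemma B_J_J:
  assumes "i < r" "j < r" "u \<in> U"
  shows "B (J i u) (J j u) = (if i = j then \<epsilon> * B u u else 0)"
proof (cases "i = j")
  case True
  then show ?thesis using assms skew[of i u "J i u"] by (simp add: U_in sq B_lin)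
next
  case False
  have "B (J i u) (J j u) = - B u (J i (J j u))" using assms skew by (simp add: U_in)
  also have "\<dots> = B u (J j (J i u))" using assms False anti[of i j u] by (simp add: B_lin)
  also have "\<dots> = - B (J j u) (J i u)" using assms skew by (simp add: U_in)
  also have "B (J j u) (J i u) = B (J i u) (J j u)" using assms sym by (simp add: J_in)
  finally show ?thesis using False by simp
qed

text \<open>
  The involution \<open>g = J\<^sub>a J\<^sub>b J\<^sub>c J\<^sub>d\<close> is symmetric, so its eigenspaces are orthogonal and one of the two
  components of \<open>x\<close> is not null. If it lies in the \<open>-1\<close> eigenspace, \<open>J\<^sub>h\<close> moves it to the other one,
  as \<open>J\<^sub>h\<close> anticommutes with \<open>g\<close>. The set \<open>S\<close> holds the involutions treated before.
\<close>

lemma fixed_vector_step: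
  assumes x: "x \<in> U" "B x x \<noteq> 0"
    and d: "distinct [a, b, c, d]" "a < r" "b < r" "c < r" "d < r" and h: "h \<in> {a, b, c, d}"
    and S: "\<And>s. s \<in> S \<Longrightarrow> linear s" "\<And>s. s \<in> S \<Longrightarrow> s x = x"
      "\<And>s u. s \<in> S \<Longrightarrow> u \<in> U \<Longrightarrow> s (J a (J b (J c (J d u)))) = J a (J b (J c (J d (s u))))"
      "\<And>s u. s \<in> S \<Longrightarrow> u \<in> U \<Longrightarrow> s (J h u) = J h (s u)"
  obtains y where "y \<in> U" "B y y \<noteq> 0" "J a (J b (J c (J d y))) = y" "\<And>s. s \<in> S \<Longrightarrow> s y = y"
proof -
  define g where "g u = J a (J b (J c (J d u)))" for u
  have "g = J a \<circ> (J b \<circ> (J c \<circ> J d))" by (auto simp: g_def)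
  then have lg: "linear g" by (simp add: linear_compose lin)
  note g_lin = linear_neg[OF lg] linear_cmul[OF lg] linear_add[OF lg] linear_diff[OF lg]
  have gU: "g u \<in> U" if "u \<in> U" for u using that d by (simp add: g_def U_in)
  have hr: "h < r" using h d by auto
  \<comment> \<open>Bringing equal factors together takes 3 + 2 + 1 transpositions, an even number,
    and the four squares contribute \<open>(- \<epsilon>)^4 = 1\<close>.\<close>
  have gg: "g (g u) = u" if u: "u \<in> U" for u
  proof -
    have "J d (J a (J b (J c (J d u)))) = \<epsilon> *\<^sub>R J a (J b (J c u))"
      using u d by (simp add: anti[of d a] anti[of d b] anti[of d c] sq U_in J_lin)
    moreover have "J c (J a (J b (J c u))) = - \<epsilon> *\<^sub>R J a (J b u)"
      using u d by (simp add: anti[of c a] anti[of c b] sq U_in J_lin)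
    moreover have "J b (J a (J b u)) = \<epsilon> *\<^sub>R J a u"
      using u d by (simp add: anti[of b a] sq U_in J_lin)
    ultimately show ?thesis
      using u d by (simp add: g_def sq U_in J_lin)
  qed
  \<comment> \<open>Reversing four anticommuting factors takes six transpositions. As the four signs
    from skewness cancel too, \<open>g\<close> is symmetric.\<close>
  have rev: "J d (J c (J b (J a u))) = g u" if u: "u \<in> U" for u
    using u d by (simp add: g_def anti[of d c] anti[of d b] anti[of d a] anti[of c b]
        anti[of c a] anti[of b a] U_in J_lin)
  have gsym: "B (g u) v = B u (g v)" if "u \<in> U" "v \<in> U" for u v
    using that d rev by (simp add: g_def skew U_in)
  have gh: "g (J h u) = - J h (g u)" if u: "u \<in> U" for u
  proof -
    consider "h = a" | "h = b" | "h = c" | "h = d" using h by auto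
    then show ?thesis
      by cases (use u d in \<open>simp_all add: g_def U_in J_lin anti[of d a] anti[of d b] anti[of d c]
          anti[of c a] anti[of c b] anti[of b a]\<close>)
  qed
  define p q where "p = (1/2) *\<^sub>R (x + g x)" and "q = (1/2) *\<^sub>R (x - g x)"
  have pU: "p \<in> U" "q \<in> U" using x gU by (simp_all add: p_def q_def U_in)
  have gp: "g p = p" "g q = - q"
    using gg[OF x(1)] by (simp_all add: p_def q_def g_lin algebra_simps)
  have "p + q = (1/2) *\<^sub>R ((x + g x) + (x - g x))" by (simp only: p_def q_def scaleR_add_right)
  then have "x = p + q" by simp
  moreover have "B p q = 0" using gsym[OF pU] gp by (simp add: B_lin)
  ultimately have "B x x = B p p + B q q" using sym[OF pU] by (simp add: B_lin)
  then consider "B p p \<noteq> 0" | "B q q \<noteq> 0" using x by fastforce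
  then show ?thesis
  proof cases
    case 1
    show ?thesis
    proof (rule that[of p])
      show "s p = p" if "s \<in> S" for s
        using S(2,3)[OF that] x(1)
        by (simp add: p_def g_def linear_cmul[OF S(1)[OF that]] linear_add[OF S(1)[OF that]])
    qed (use 1 pU gp in \<open>simp_all add: g_def\<close>)
  next
    case 2
    show ?thesis
    proof (rule that[of "J h q"])
      show "B (J h q) (J h q) \<noteq> 0" using 2 eps B_J_J[OF hr hr pU(2)] by auto
      show "J a (J b (J c (J d (J h q)))) = J h q"
        using gh[OF pU(2)] gp by (simp add: g_def J_lin)
      show "s (J h q) = J h q" if "s \<in> S" for s
      proof -
        have "s q = q"
          using S(2,3)[OF that] x(1)
          by (simp add: q_def g_def linear_cmul[OF S(1)[OF that]] linear_diff[OF S(1)[OF that]])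
        then show ?thesis using S(4)[OF that pU(2)] by simp
      qed
    qed (use pU hr in \<open>simp add: U_in\<close>)
  qed
qed

text \<open>Applying \<open>J k\<close> leaves a multiple of \<open>J l x\<close> on the right and
  \<open>J j (J k (J i x))\<close> on the left; applying \<open>J j\<close> then frees
  \<open>J k (J i x)\<close>. The squares of \<open>J k\<close> and \<open>J j\<close> give the same
  factor \<open>- \<epsilon>\<close> on the two sides, so the result does not depend on the
  signature.\<close>

lemma middle_swap:
  assumes "i < r" "j < r" "k < r" "l < r" "i \<noteq> j" "i \<noteq> k" "j \<noteq> k" "x \<in> U"
    and "J i (J j x) = s *\<^sub>R J k (J l x)"
  shows "J i (J k x) = (- s) *\<^sub>R J j (J l x)"
proof -
  have "J k (J i (J j x)) = (- s * \<epsilon>) *\<^sub>R J l x"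
    unfolding assms(9) using assms(1-8) by (simp add: J_lin sq U_in)
  moreover have "J k (J i (J j x)) = J j (J k (J i x))"
    using assms(1-8) by (simp add: anti[of i j] anti[of k j] U_in J_lin)
  ultimately have "J j (J j (J k (J i x))) = (- s * \<epsilon>) *\<^sub>R J j (J l x)"
    by (simp add: J_lin)
  moreover have "J j (J j (J k (J i x))) = - \<epsilon> *\<^sub>R J k (J i x)"
    using assms(1-8) by (simp add: sq U_in)
  ultimately have "J k (J i x) = s *\<^sub>R J j (J l x)" using eps by (elim disjE) simp_all
  then show ?thesis using assms anti[of i k x] by simp
qed

text \<open>With \<open>J 0\<close> moved next to \<open>x\<close>, the relation is an instance of
  \<open>middle_swap\<close> whose last index is 0.\<close>

lemma line_rotate:
  assumes "0 < i" "0 < j" "0 < l" "i < r" "j < r" "l < r" "i \<noteq> j" "i \<noteq> l" "j \<noteq> l" "x \<in> U"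
    and "J i (J j x) = - J 0 (J l x)"
  shows "J l (J i x) = - J 0 (J j x)"
proof -
  have "J i (J j x) = 1 *\<^sub>R J l (J 0 x)" using assms(3,6,10,11) anti[of 0 l x] by simp
  then have "J i (J l x) = - 1 *\<^sub>R J j (J 0 x)"
    using assms(1-10) middle_swap[of i j l 0 x 1] by simp
  moreover have "J l (J i x) = - J i (J l x)" using assms(1-10) anti[of l i x] by simp
  moreover have "J 0 (J j x) = - J j (J 0 x)" using assms(1-10) anti[of 0 j x] by simp
  ultimately show ?thesis by simp
qed

text \<open>The product of \<open>J a\<close> and \<open>J b\<close> squares to
  \<open>- \<epsilon> * \<epsilon> = - 1\<close>, so applying it to the hypothesis isolates the
  other two factors.\<close>

lemma quad_fixed:
  assumes "a < r" "b < r" "c < r" "d < r" "a \<noteq> b" "x \<in> U"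
    and "J a (J b (J c (J d x))) = x"
  shows "J c (J d x) = - J a (J b x)"
proof -
  let ?w = "J c (J d x)"
  have w: "?w \<in> U" using assms by (simp add: U_in)
  have "J a (J b x) = J a (J b (J a (J b ?w)))" using assms(7) by simp
  also have "J b (J a (J b ?w)) = \<epsilon> *\<^sub>R J a ?w"
    using assms(1-6) w anti[of b a "J b ?w"] by (simp add: U_in sq J_lin)
  also have "J a (\<epsilon> *\<^sub>R J a ?w) = - ?w"
    using assms(1-6) w by (simp add: U_in sq J_lin)
  finally show ?thesis by simp
qed

lemma fano_from_lines:
  assumes x: "x \<in> U"
    and base: "\<And>a b c. (a, b, c) \<in> fano_lines \<Longrightarrow> a < r \<Longrightarrow> b < r \<Longrightarrow> c < r \<Longrightarrow>
      J a (J b x) = - J 0 (J c x)"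
    and ijl: "(i, j, l) \<in> fano" "i < r" "j < r" "l < r"
  shows "J i (J j x) = - J 0 (J l x)"
proof -
  obtain a b c where abc: "(a, b, c) \<in> fano_lines" "(i, j, l) \<in> {(a, b, c), (b, c, a), (c, a, b)}"
    using ijl(1) unfolding fano_def by blast
  have lt: "a < r" "b < r" "c < r" using abc(2) ijl by auto
  have d: "0 < a" "0 < b" "0 < c" "a \<noteq> b" "a \<noteq> c" "b \<noteq> c"
    using abc(1) unfolding fano_lines_def by auto
  have 1: "J a (J b x) = - J 0 (J c x)" using base abc(1) lt .
  have 2: "J c (J a x) = - J 0 (J b x)" using line_rotate[of a b c x] 1 d lt x by blast
  have 3: "J b (J c x) = - J 0 (J a x)" using line_rotate[of c a b x] 2 d lt x by blast
  show ?thesis using abc(2) 1 2 3 by auto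
qed

lemma fano_vector_four:
  assumes "r = 4" "x \<in> U" "B x x \<noteq> 0"
  obtains y where "y \<in> U" "B y y \<noteq> 0"
    "\<And>a b c. (a, b, c) \<in> fano_lines \<Longrightarrow> a < r \<Longrightarrow> b < r \<Longrightarrow> c < r \<Longrightarrow> J a (J b y) = - J 0 (J c y)"
proof -
  obtain y where y: "y \<in> U" "B y y \<noteq> 0" "J 0 (J 1 (J 2 (J 3 y))) = y"
    using fixed_vector_step[of x 0 1 2 3 0 "{}"] assms by auto
  have *: "J 2 (J 3 y) = - J 0 (J 1 y)" using quad_fixed[of 0 1 2 3 y] y \<open>r = 4\<close> by simp
  have "J 1 (J 2 y) = - J 0 (J 3 y)" using line_rotate[of 2 3 1 y] * y(1) \<open>r = 4\<close> by simp
  then show ?thesis using that[OF y(1,2)] \<open>r = 4\<close> unfolding fano_lines_def by auto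
qed

text \<open>Any two of the four quadruples share exactly two indices, so the involutions commute.
  Each later step needs an \<open>h\<close> in the new quadruple but in none of the earlier ones, so
  that \<open>J h\<close> commutes with the earlier involutions: 3, 5 and 7 serve. The quadruple
  0246 comes first because each of its indices occurs in another quadruple.\<close>

lemma fano_vector_eight:
  assumes r8: "r = 8" and x0: "x0 \<in> U" "B x0 x0 \<noteq> 0"
  obtains x where "x \<in> U" "B x x \<noteq> 0"
    "\<And>a b c. (a, b, c) \<in> fano_lines \<Longrightarrow> a < r \<Longrightarrow> b < r \<Longrightarrow> c < r \<Longrightarrow> J a (J b x) = - J 0 (J c x)"
proof -
  define q where "q a b c d u = J a (J b (J c (J d u)))" for a b c d u
  have lq: "linear (q a b c d)" for a b c d
  proof -
    have "q a b c d = J a \<circ> (J b \<circ> (J c \<circ> J d))" by (auto simp: q_def)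
    then show ?thesis by (simp add: linear_compose lin)
  qed
  \<comment> \<open>As a rewrite rule, \<open>anti_sort\<close> orders products of generators by
    index, which decides the commutation claims below.\<close>
  note srt = q_def anti_sort U_in J_lin r8
  obtain x1 where x1: "x1 \<in> U" "B x1 x1 \<noteq> 0" "q 0 2 4 6 x1 = x1"
    using fixed_vector_step[of x0 0 2 4 6 0 "{}"] x0 r8 unfolding q_def by auto
  obtain x2 where x2: "x2 \<in> U" "B x2 x2 \<noteq> 0" "q 0 1 2 3 x2 = x2" "q 0 2 4 6 x2 = x2"
  proof (rule fixed_vector_step[OF x1(1,2), of 0 1 2 3 3 "{q 0 2 4 6}"])
    show "s (J 0 (J 1 (J 2 (J 3 u)))) = J 0 (J 1 (J 2 (J 3 (s u))))"
      if "s \<in> {q 0 2 4 6}" "u \<in> U" for s u using that by (simp add: srt)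
    show "s (J 3 u) = J 3 (s u)" if "s \<in> {q 0 2 4 6}" "u \<in> U" for s u using that by (simp add: srt)
  qed (use x1 lq r8 that in \<open>auto simp flip: q_def\<close>)
  obtain x3 where x3: "x3 \<in> U" "B x3 x3 \<noteq> 0" "q 0 1 4 5 x3 = x3" "q 0 1 2 3 x3 = x3"
    "q 0 2 4 6 x3 = x3"
  proof (rule fixed_vector_step[OF x2(1,2), of 0 1 4 5 5 "{q 0 1 2 3, q 0 2 4 6}"])
    show "s (J 0 (J 1 (J 4 (J 5 u)))) = J 0 (J 1 (J 4 (J 5 (s u))))"
      if "s \<in> {q 0 1 2 3, q 0 2 4 6}" "u \<in> U" for s u using that by (auto simp: srt)
    show "s (J 5 u) = J 5 (s u)" if "s \<in> {q 0 1 2 3, q 0 2 4 6}" "u \<in> U" for s u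
      using that by (auto simp: srt)
  qed (use x2 lq r8 that in \<open>auto simp flip: q_def\<close>)
  obtain x where x: "x \<in> U" "B x x \<noteq> 0" "q 0 1 6 7 x = x" "q 0 1 4 5 x = x" "q 0 1 2 3 x = x"
    "q 0 2 4 6 x = x"
  proof (rule fixed_vector_step[OF x3(1,2), of 0 1 6 7 7 "{q 0 1 4 5, q 0 1 2 3, q 0 2 4 6}"])
    show "s (J 0 (J 1 (J 6 (J 7 u)))) = J 0 (J 1 (J 6 (J 7 (s u))))"
      if "s \<in> {q 0 1 4 5, q 0 1 2 3, q 0 2 4 6}" "u \<in> U" for s u using that by (auto simp: srt)
    show "s (J 7 u) = J 7 (s u)" if "s \<in> {q 0 1 4 5, q 0 1 2 3, q 0 2 4 6}" "u \<in> U" for s u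
      using that by (auto simp: srt)
  qed (use x3 lq r8 that in \<open>auto simp flip: q_def\<close>)
  note xU = x(1)
  have 231: "J 2 (J 3 x) = - J 0 (J 1 x)" using quad_fixed[of 0 1 2 3 x] x r8 by (simp add: q_def)
  have 451: "J 4 (J 5 x) = - J 0 (J 1 x)" using quad_fixed[of 0 1 4 5 x] x r8 by (simp add: q_def)
  have 671: "J 6 (J 7 x) = - J 0 (J 1 x)" using quad_fixed[of 0 1 6 7 x] x r8 by (simp add: q_def)
  have 462: "J 4 (J 6 x) = - J 0 (J 2 x)" using quad_fixed[of 0 2 4 6 x] x r8 by (simp add: q_def)
  have 123: "J 1 (J 2 x) = - J 0 (J 3 x)" using line_rotate[of 2 3 1 x] 231 xU r8 by simp
  have 145: "J 1 (J 4 x) = - J 0 (J 5 x)" using line_rotate[of 4 5 1 x] 451 xU r8 by simp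
  have 167: "J 1 (J 6 x) = - J 0 (J 7 x)" using line_rotate[of 6 7 1 x] 671 xU r8 by simp
  have 246: "J 2 (J 4 x) = - J 0 (J 6 x)" using line_rotate[of 4 6 2 x] 462 xU r8 by simp
  have 624: "J 6 (J 2 x) = - J 0 (J 4 x)" using line_rotate[of 2 4 6 x] 246 xU r8 by simp
  \<comment> \<open>The remaining lines \<open>(2,7,5)\<close>, \<open>(3,7,4)\<close> and
    \<open>(3,6,5)\<close> arise by equating two of the three products that equal
    \<open>- J 0 (J 1 x)\<close> and applying \<open>middle_swap\<close>.\<close>
  have "J 4 (J 6 x) = - 1 *\<^sub>R J 5 (J 7 x)"
    using middle_swap[of 4 5 6 7 x 1] 451 671 xU r8 by simp
  then have "J 7 (J 5 x) = - J 0 (J 2 x)" using 462 anti[of 7 5 x] xU r8 by simp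
  then have 275: "J 2 (J 7 x) = - J 0 (J 5 x)" using line_rotate[of 7 5 2 x] xU r8 by simp
  have "J 2 (J 6 x) = - 1 *\<^sub>R J 3 (J 7 x)"
    using middle_swap[of 2 3 6 7 x 1] 231 671 xU r8 by simp
  then have 374: "J 3 (J 7 x) = - J 0 (J 4 x)" using 624 anti[of 2 6 x] xU r8 by simp
  have "J 2 (J 7 x) = J 3 (J 6 x)"
    using middle_swap[of 2 3 7 6 x "-1"] anti[of 7 6 x] 231 671 xU r8 by simp
  then have 365: "J 3 (J 6 x) = - J 0 (J 5 x)" using 275 by simp
  show ?thesis
    using that[OF x(1,2)] 123 145 167 246 275 374 365 unfolding fano_lines_def by auto
qed

lemma fano_vector:
  assumes "x0 \<in> U" "B x0 x0 \<noteq> 0"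
  obtains x where "x \<in> U" "B x x \<noteq> 0"
    "\<And>i j l. (i, j, l) \<in> fano \<Longrightarrow> i < r \<Longrightarrow> j < r \<Longrightarrow> l < r \<Longrightarrow> J i (J j x) = - J 0 (J l x)"
proof -
  obtain x where x: "x \<in> U" "B x x \<noteq> 0"
    "\<And>a b c. (a, b, c) \<in> fano_lines \<Longrightarrow> a < r \<Longrightarrow> b < r \<Longrightarrow> c < r \<Longrightarrow> J a (J b x) = - J 0 (J c x)"
  proof -
    consider "r \<le> 2" | "r = 4" | "r = 8" using r by auto
    then show ?thesis
    proof cases
      case 1
      then show ?thesis using that[OF assms] unfolding fano_lines_def by auto
    qed (use fano_vector_four fano_vector_eight assms that in metis)+
  qed
  show ?thesis using that[OF x(1,2)] fano_from_lines[OF x(1) x(3)] by blast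
qed

end

section \<open>The orthogonal frame generated by a fixed vector\<close>

locale clifford_frame = clifford_system U B J r \<epsilon>
  for U :: "'u::real_vector set" and B J r \<epsilon> +
  fixes x :: 'u
  assumes x_in: "x \<in> U" and x_norm: "B x x \<noteq> 0"
    and fano_rel: "(i, j, l) \<in> fano \<Longrightarrow> i < r \<Longrightarrow> j < r \<Longrightarrow> l < r \<Longrightarrow> J i (J j x) = - J 0 (J l x)"
begin

lemma J_J_x:
  assumes "pair_rel i j l s" "i < r" "j < r" "l < r"
  shows "J i (J j x) = s *\<^sub>R J 0 (J l x)"
proof -
  have "J i (J j x) = J 0 (J l x)" if "(j, i, l) \<in> fano"
  proof -
    have "J j (J i x) = - J 0 (J l x)" using fano_rel that assms by simp
    moreover have "J i (J j x) = - J j (J i x)"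
      using anti[of i j x] fano_distinct[OF that] assms x_in by simp
    ultimately show ?thesis by simp
  qed
  moreover have "J i (J j x) = - J 0 (J l x)" if "(i, j, l) \<in> fano"
    using fano_rel that assms by blast
  moreover have "J i (J 0 x) = - J 0 (J i x)" if "i \<noteq> 0"
    using anti[of i 0 x] that assms r_pos x_in by simp
  moreover have "J i (J i x) = J 0 (J 0 x)" using sq[OF _ x_in] assms r_pos by simp
  ultimately show ?thesis
    using assms(1) unfolding pair_rel_def by (elim disjE conjE) simp_all
qed

lemma J_odd:
  assumes "pair_rel i j l s" "i < r" "j < r" "l < r"
  shows "J i (J j x) = line_sign l s *\<^sub>R J l (J 0 x)"
  using J_J_x[OF assms] assms r_pos anti[of 0 l x] x_in by (simp add: line_sign_def)

text \<open>Parity counts the generators applied to \<open>x\<close>. For nonzero \<open>i\<close>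
  and \<open>k\<close>, moving \<open>J 0\<close> to the front makes it meet the \<open>J 0\<close>
  in \<open>J i (J k x) = s *\<^sub>R J 0 (J l x)\<close>, where it squares to a scalar. With
  \<open>J_odd\<close> this makes the span of the frame invariant.\<close>

lemma J_even:
  assumes "i < r" "k < r"
  obtains m t where "m < r" "J i (J k (J 0 x)) = t *\<^sub>R J m x"
proof -
  consider "k = 0" | "i = 0" "k \<noteq> 0" | "i \<noteq> 0" "k \<noteq> 0" by blast
  then show ?thesis
  proof cases
    case 1
    have "J i (J k (J 0 x)) = (- \<epsilon>) *\<^sub>R J i x" using 1 r_pos x_in sq[of 0 x] by (simp add: J_lin)
    then show ?thesis using that assms by blast
  next
    case 2
    have "J i (J k (J 0 x)) = \<epsilon> *\<^sub>R J k x"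
      using 2 assms r_pos x_in by (simp add: anti[of k 0 x] J_lin sq U_in)
    then show ?thesis using that assms by blast
  next
    case 3
    obtain l s where l: "l < r" "pair_rel i k l s" using pair_rel_ex[OF r assms] by blast
    have "J i (J k (J 0 x)) = J 0 (J i (J k x))"
      using 3 assms r_pos x_in by (simp add: anti[of k 0 x] anti[of i 0 "J k x"] J_lin U_in)
    also have "\<dots> = (- \<epsilon> * s) *\<^sub>R J l x"
      using J_J_x[OF l(2) assms l(1)] l(1) r_pos x_in by (simp add: J_lin sq U_in)
    finally show ?thesis using that l(1) by blast
  qed
qed

fun frame :: "nat \<times> bool \<Rightarrow> 'u" where
  "frame (i, False) = J i x"
| "frame (i, True) = J i (J 0 x)"

abbreviation "frame_index \<equiv> {..<r} \<times> (UNIV :: bool set)"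

lemma frame_in: "p \<in> frame_index \<Longrightarrow> frame p \<in> U"
  by (cases p rule: frame.cases) (auto simp: U_in x_in r_pos)

lemma span_frame_subset: "span (frame ` frame_index) \<subseteq> U"
  using sub frame_in by (intro span_minimal) auto

text \<open>By skewness \<open>J b\<close> moves to the even side, where \<open>J_even\<close>
  leaves a multiple of some \<open>J m x\<close>, and this is orthogonal to
  \<open>x\<close>.\<close>

lemma B_even_odd:
  assumes "k < r" "b < r"
  shows "B (J k (J 0 x)) (J b x) = 0"
proof -
  obtain m t where m: "m < r" "J b (J k (J 0 x)) = t *\<^sub>R J m x" using J_even assms by metis
  have "B (J k (J 0 x)) (J b x) = - B (J b (J k (J 0 x))) x"
    using skew[of b "J k (J 0 x)" x] assms x_in r_pos by (simp add: U_in)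
  also have "\<dots> = 0" using B_J_self[OF m(1) x_in] m(2) by (simp add: B_lin)
  finally show ?thesis .
qed

lemma B_odd_even:
  assumes "k < r" "b < r"
  shows "B (J b x) (J k (J 0 x)) = 0"
  using B_even_odd[OF assms] sym[of "J b x" "J k (J 0 x)"] assms x_in r_pos by (simp add: U_in)

lemma B_frame:
  assumes "p \<in> frame_index" "q \<in> frame_index"
  shows "B (frame p) (frame q) = (if p = q then (if snd p then 1 else \<epsilon>) * B x x else 0)"
proof -
  have "B (J 0 x) (J 0 x) = \<epsilon> * B x x" using B_J_J[of 0 0 x] r_pos x_in by simp
  then show ?thesis
    using assms B_J_J[of _ _ x] B_J_J[of _ _ "J 0 x"] B_even_odd B_odd_even r_pos x_in
    by (cases p rule: frame.cases; cases q rule: frame.cases) (auto simp: J_in)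
qed

text \<open>Here the signature disappears: \<open>J i (J j x)\<close> is a signed even frame vector,
  and even frame vectors have norm \<open>\<epsilon> * \<epsilon> * B x x = B x x\<close>.\<close>

lemma B_J_odd_even:
  assumes "i < r" "j < r" "k < r"
  shows "B (J i (J j x)) (J k (J 0 x)) = B x x * trilinear_coeff r i j k"
proof -
  obtain l s where ls: "(SOME (l, s). l < r \<and> pair_rel i j l s) = (l, s)"
    by (cases "SOME (l, s). l < r \<and> pair_rel i j l s")
  have "\<exists>p. case p of (l, s) \<Rightarrow> l < r \<and> pair_rel i j l s"
    using pair_rel_ex[OF r assms(1,2)] by auto
  then have "case (l, s) of (l, s) \<Rightarrow> l < r \<and> pair_rel i j l s"
    unfolding ls[symmetric] by (rule someI_ex)
  then have l: "l < r" "pair_rel i j l s" by auto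
  have "B (J i (J j x)) (J k (J 0 x)) = line_sign l s * B (frame (l, True)) (frame (k, True))"
    using J_odd[OF l(2) assms(1,2) l(1)] by (simp add: B_lin)
  also have "\<dots> = B x x * trilinear_coeff r i j k"
    using l(1) assms by (subst B_frame) (auto simp: trilinear_coeff_def ls)
  finally show ?thesis .
qed

text \<open>Each \<open>J i\<close> reverses parity, so pairs of equal parity give 0. The even-odd
  case follows from the odd-even one by skewness.\<close>

lemma B_J_frame:
  assumes "i < r" "p \<in> frame_index" "q \<in> frame_index"
  shows "B (J i (frame p)) (frame q) = B x x * structure_coeff r i p q"
proof -
  have odd: "B (J i (J j x)) (J k x) = 0" if jk: "j < r" "k < r" for j k
  proof -
    obtain l s where "l < r" "pair_rel i j l s" using pair_rel_ex[OF r assms(1) jk(1)] by blast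
    then show ?thesis using J_odd[of i j l s] assms(1) jk B_even_odd by (simp add: B_lin)
  qed
  have even: "B (J i (J j (J 0 x))) (J k (J 0 x)) = 0" if jk: "j < r" "k < r" for j k
  proof -
    obtain m t where "m < r" "J i (J j (J 0 x)) = t *\<^sub>R J m x"
      using J_even[OF assms(1) jk(1)] by blast
    then show ?thesis using B_odd_even jk by (simp add: B_lin)
  qed
  have mixed: "B (J i (J j (J 0 x))) (J k x) = - (B x x * trilinear_coeff r i k j)"
    if "j < r" "k < r" for j k
  proof -
    have "B (J i (J j (J 0 x))) (J k x) = - B (J j (J 0 x)) (J i (J k x))"
      using skew that assms(1) x_in r_pos by (simp add: U_in)
    also have "\<dots> = - B (J i (J k x)) (J j (J 0 x))"
      using sym that assms(1) x_in r_pos by (simp add: U_in)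
    finally show ?thesis using B_J_odd_even that assms(1) by simp
  qed
  show ?thesis
    using assms B_J_odd_even odd even mixed
    by (cases p rule: frame.cases; cases q rule: frame.cases) auto
qed

lemma J_span_frame:
  assumes "i < r" "u \<in> span (frame ` frame_index)"
  shows "J i u \<in> span (frame ` frame_index)"
proof -
  have base: "J i (frame p) \<in> span (frame ` frame_index)" if p: "p \<in> frame_index" for p
  proof (cases p rule: frame.cases)
    case (1 j)
    obtain l s where l: "l < r" "pair_rel i j l s" using pair_rel_ex[OF r assms(1)] 1 p by blast
    have eq: "J i (frame p) = line_sign l s *\<^sub>R frame (l, True)"
      using J_odd[OF l(2) assms(1) _ l(1)] 1 p by simp
    have "frame (l, True) \<in> frame ` frame_index" using l(1) by blast
    then show ?thesis unfolding eq by (intro span_scale span_base)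
  next
    case (2 j)
    obtain m t where m: "m < r" "J i (J j (J 0 x)) = t *\<^sub>R J m x" using J_even assms(1) 2 p by blast
    then have eq: "J i (frame p) = t *\<^sub>R frame (m, False)" using 2 by simp
    have "frame (m, False) \<in> frame ` frame_index" using m(1) by blast
    then show ?thesis unfolding eq by (intro span_scale span_base)
  qed
  have "J i ` span (frame ` frame_index) = span (J i ` frame ` frame_index)"
    by (rule linear_span_image[OF lin, symmetric])
  also have "\<dots> \<subseteq> span (frame ` frame_index)"
    using base by (intro span_minimal) auto
  finally show ?thesis using assms(2) by blast
qed

text \<open>The projection onto the span of the frame fixes \<open>u\<close>, and it kills
  \<open>u\<close> because \<open>u\<close> is orthogonal to the frame.\<close>

lemma nondegenerate_span_frame:
  assumes "u \<in> span (frame ` frame_index)" "\<And>v. v \<in> span (frame ` frame_index) \<Longrightarrow> B u v = 0"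
  shows "u = 0"
proof -
  have n: "B (frame q) (frame q) \<noteq> 0" if "q \<in> frame_index" for q
    using B_frame[OF that that] x_norm eps by auto
  obtain \<pi> where \<pi>: "linear \<pi>" "\<And>p. p \<in> frame_index \<Longrightarrow> \<pi> (frame p) = frame p"
    "\<And>u. (\<And>p. p \<in> frame_index \<Longrightarrow> B u (frame p) = 0) \<Longrightarrow> \<pi> u = 0"
    using orthogonal_extend[OF _ bil, where I = frame_index and b = frame and b' = frame] B_frame n by auto
  have "\<pi> u = id u"
    by (rule linear_eq_on[OF \<pi>(1) linear_id assms(1)]) (use \<pi>(2) in auto)
  moreover have "\<pi> u = 0" by (intro \<pi>(3) assms(2) span_base imageI)
  ultimately show ?thesis by simp
qed

end

section \<open>Frames in minimal admissible modules\<close>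

definition coordinate_map :: "(nat \<Rightarrow> 'n) \<Rightarrow> (real ^ 'n \<Rightarrow> 'u \<Rightarrow> 'u) \<Rightarrow> nat \<Rightarrow> 'u \<Rightarrow> 'u" where
  "coordinate_map e J i = J (axis (e i) 1)"

lemma clifford_system_of_admissible:
  fixes P :: "'n::finite set" and U :: "'u::real_vector set"
  assumes adm: "admissible_module P U J B"
    and form: "\<And>z w. pseudo_inner P z w = \<epsilon> * (z \<bullet> w)" and eps: "\<epsilon> = 1 \<or> \<epsilon> = - 1"
    and e: "inj_on e {..<r}" and r: "r \<in> {1, 2, 4, 8}"
  shows "clifford_system U B (coordinate_map e J) r \<epsilon>"
proof -
  have bJ: "bilinear J" and bB: "bilinear B"
    and JU: "\<And>z u. u \<in> U \<Longrightarrow> J z u \<in> U"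
    and J2: "\<And>z u. u \<in> U \<Longrightarrow> J z (J z u) = - pseudo_inner P z z *\<^sub>R u"
    and symB: "\<And>u v. u \<in> U \<Longrightarrow> v \<in> U \<Longrightarrow> B u v = B v u"
    and nondeg: "\<And>u. u \<in> U \<Longrightarrow> \<forall>v\<in>U. B u v = 0 \<Longrightarrow> u = 0"
    and fin: "\<exists>F. finite F \<and> U = span F"
    using adm unfolding admissible_module_def clifford_module_def by simp_all
  have "\<forall>z. \<forall>u\<in>U. \<forall>v\<in>U. B (J z u) v + B u (J z v) = 0"
    using adm unfolding admissible_module_def by (elim conjE)
  then have skewB: "B (J z u) v + B u (J z v) = 0" if "u \<in> U" "v \<in> U" for z u v
    using that by blast
  have sub: "subspace U" using fin by (metis subspace_span)
  have sq: "J z (J z u) = (- \<epsilon> * (z \<bullet> z)) *\<^sub>R u" if "u \<in> U" for z u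
    using J2[OF that] form by simp
  have polar: "J z (J w u) + J w (J z u) = (- 2 * \<epsilon> * (z \<bullet> w)) *\<^sub>R u" if "u \<in> U" for z w u
  proof -
    \<comment> \<open>Polarising the square relation yields the anticommutation of generators for
      orthogonal vectors.\<close>
    have "J (z + w) (J (z + w) u) =
        J z (J z u) + J w (J w u) + (J z (J w u) + J w (J z u))"
      by (simp add: bilinear_ladd[OF bJ] bilinear_radd[OF bJ] algebra_simps)
    then have "J z (J w u) + J w (J z u) = (- \<epsilon> * ((z + w) \<bullet> (z + w))) *\<^sub>R u
        - (- \<epsilon> * (z \<bullet> z)) *\<^sub>R u - (- \<epsilon> * (w \<bullet> w)) *\<^sub>R u"
      using sq[OF that] by simp
    also have "\<dots> = (- 2 * \<epsilon> * (z \<bullet> w)) *\<^sub>R u"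
      unfolding scaleR_diff_left[symmetric]
      by (simp add: inner_add_left inner_add_right inner_commute algebra_simps)
    finally show ?thesis .
  qed
  show ?thesis
  proof (rule clifford_system.intro)
    show "linear (coordinate_map e J i)" for i
      using bJ unfolding coordinate_map_def bilinear_def by blast
    show "coordinate_map e J i (coordinate_map e J i u) = - \<epsilon> *\<^sub>R u" if "i < r" "u \<in> U" for i u
      using sq[OF that(2)] by (simp add: coordinate_map_def inner_axis_axis)
    show "coordinate_map e J i (coordinate_map e J j u) = - coordinate_map e J j (coordinate_map e J i u)"
      if "i < r" "j < r" "i \<noteq> j" "u \<in> U" for i j u
    proof -
      have "e i \<noteq> e j" using e that by (auto dest: inj_onD)
      then show ?thesis
        using polar[OF that(4), of "axis (e i) 1" "axis (e j) 1"]
        by (simp add: coordinate_map_def inner_axis_axis eq_neg_iff_add_eq_0)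
    qed
    show "B (coordinate_map e J i u) v = - B u (coordinate_map e J i v)"
      if "i < r" "u \<in> U" "v \<in> U" for i u v
    proof -
      have "B (J (axis (e i) 1) u) v + B u (J (axis (e i) 1) v) = 0" using skewB that by blast
      then show ?thesis unfolding coordinate_map_def by linarith
    qed
    show "B u v = B v u" if "u \<in> U" "v \<in> U" for u v using symB that by blast
  qed (use sub bB eps r JU in \<open>simp_all add: coordinate_map_def\<close>)
qed

lemma minimal_admissible_frame:
  fixes P :: "'n::finite set" and U :: "'u::real_vector set"
  assumes min: "minimal_admissible_module P U J B"
    and form: "\<And>z w. pseudo_inner P z w = \<epsilon> * (z \<bullet> w)" and eps: "\<epsilon> = 1 \<or> \<epsilon> = - 1"
    and e: "bij_betw e {..<r} UNIV" and r: "r \<in> {1, 2, 4, 8}"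
  obtains x where "clifford_frame U B (coordinate_map e J) r \<epsilon> x"
    "U = span (clifford_frame.frame (coordinate_map e J) x ` ({..<r} \<times> UNIV))"
proof -
  have adm: "admissible_module P U J B" and nz: "U \<noteq> {0}"
    using min by (auto simp: minimal_admissible_module_def)
  have bJ: "bilinear J" and bB: "bilinear B"
    and JU: "\<And>z u. u \<in> U \<Longrightarrow> J z u \<in> U"
    and J2: "\<And>z u. u \<in> U \<Longrightarrow> J z (J z u) = - pseudo_inner P z z *\<^sub>R u"
    and symB: "\<And>u v. u \<in> U \<Longrightarrow> v \<in> U \<Longrightarrow> B u v = B v u"
    and nondeg: "\<And>u. u \<in> U \<Longrightarrow> \<forall>v\<in>U. B u v = 0 \<Longrightarrow> u = 0"
    and fin: "\<exists>F. finite F \<and> U = span F"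
    using adm unfolding admissible_module_def clifford_module_def by simp_all
  have "\<forall>z. \<forall>u\<in>U. \<forall>v\<in>U. B (J z u) v + B u (J z v) = 0"
    using adm unfolding admissible_module_def by (elim conjE)
  then have skewB: "B (J z u) v + B u (J z v) = 0" if "u \<in> U" "v \<in> U" for z u v
    using that by blast
  interpret clifford_system U B "coordinate_map e J" r \<epsilon>
    using clifford_system_of_admissible[OF adm form eps _ r] e by (auto simp: bij_betw_def)
  \<comment> \<open>If every vector were null, polarisation would make \<open>B\<close> vanish on
    \<open>U\<close>, against nondegeneracy and \<open>U \<noteq> {0}\<close>.\<close>
  have "\<exists>x0\<in>U. B x0 x0 \<noteq> 0"
  proof (rule ccontr)
    assume "\<not> ?thesis"
    then have null: "B u u = 0" if "u \<in> U" for u using that by blast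
    have "B u v = 0" if "u \<in> U" "v \<in> U" for u v
      using null[of "u + v"] null[OF that(1)] null[OF that(2)] sym[OF that] that
      by (simp add: B_lin U_in)
    then have "u = 0" if "u \<in> U" for u using nondeg that by blast
    then show False using nz subspace_0[OF sub] by auto
  qed
  then obtain x0 where x0: "x0 \<in> U" "B x0 x0 \<noteq> 0" by blast
  obtain x where x: "x \<in> U" "B x x \<noteq> 0"
    "\<And>i j l. (i, j, l) \<in> fano \<Longrightarrow> i < r \<Longrightarrow> j < r \<Longrightarrow> l < r \<Longrightarrow>
      coordinate_map e J i (coordinate_map e J j x) = - coordinate_map e J 0 (coordinate_map e J l x)"
    using fano_vector[OF x0] by blast
  interpret clifford_frame U B "coordinate_map e J" r \<epsilon> x
    using x by unfold_locales auto
  define S where "S = span (frame ` frame_index)"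
  have SU: "S \<subseteq> U" unfolding S_def by (rule span_frame_subset)
  have subS: "subspace S" unfolding S_def by (rule subspace_span)
  have JS: "J z u \<in> S" if "u \<in> S" for z u
  proof -
    have ax: "J (axis m 1) u \<in> S" for m
    proof -
      have "m \<in> e ` {..<r}" using e by (simp add: bij_betw_def)
      then obtain i where "i < r" "e i = m" by blast
      then show ?thesis using J_span_frame[of i u] that by (auto simp: S_def coordinate_map_def)
    qed
    have lJ: "linear (\<lambda>z. J z u)" using bJ by (simp add: bilinear_def)
    have "J z u = J (\<Sum>m\<in>UNIV. z $ m *\<^sub>R axis m 1) u"
      using basis_expansion[of z] by (simp add: scalar_mult_eq_scaleR)
    also have "\<dots> = (\<Sum>m\<in>UNIV. z $ m *\<^sub>R J (axis m 1) u)"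
      by (simp only: linear_sum[OF lJ] linear_cmul[OF lJ])
    finally show ?thesis using ax by (simp add: subspace_sum subspace_scale subS)
  qed
  have "finite (frame ` frame_index)" by simp
  then have "\<exists>F. finite F \<and> S = span F" unfolding S_def by blast
  moreover have "u = 0" if "u \<in> S" "\<forall>v\<in>S. B u v = 0" for u
    using nondegenerate_span_frame[of u] that by (simp add: S_def)
  moreover have "B u v = B v u" "B (J z u) v + B u (J z v) = 0" if "u \<in> S" "v \<in> S" for z u v
    using SU that by (auto intro: symB skewB)
  moreover have "J z (J z u) = - pseudo_inner P z z *\<^sub>R u" if "u \<in> S" for z u
    using SU that J2 by blast
  ultimately have "admissible_module P S J B"
    unfolding admissible_module_def clifford_module_def using bJ bB JS by simp
  moreover have "S \<noteq> {0}"
  proof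
    assume "S = {0}"
    moreover have "frame (0, False) \<in> S" unfolding S_def using r_pos by (intro span_base imageI) auto
    ultimately have "frame (0, False) = 0" by blast
    then have "B (frame (0, False)) (frame (0, False)) = 0" by (simp add: bilinear_lzero[OF bB])
    then show False using B_frame[of "(0, False)" "(0, False)"] r_pos x(2) eps by auto
  qed
  ultimately have "dim U \<le> dim S" using min unfolding minimal_admissible_module_def by blast
  moreover obtain F where "finite F" "U = span F" using fin by blast
  ultimately have "S = U" using subspace_eq_if_dim_le[OF subS SU] by blast
  then show ?thesis
    using that[of x] clifford_frame_axioms unfolding S_def by blast
qed

section \<open>The isomorphism between the two signatures\<close>

theorem theorem4:
  fixes r :: nat
    and P :: "'n::finite set" and Q :: "'m::finite set"
    and U :: "'u::real_vector set" and J :: "real ^ 'n \<Rightarrow> 'u \<Rightarrow> 'u" and B :: "'u \<Rightarrow> 'u \<Rightarrow> real"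
    and W :: "'w::real_vector set" and K :: "real ^ 'm \<Rightarrow> 'w \<Rightarrow> 'w" and C :: "'w \<Rightarrow> 'w \<Rightarrow> real"
  assumes "r \<in> {1, 2, 4, 8}"
    and "card P = r" and "card (- P) = 0"
    and "card Q = 0" and "card (- Q) = r"
    and "minimal_admissible_module P U J B"
    and "minimal_admissible_module Q W K C"
  shows "lie_algebra_isomorphic (nr_carrier U) (nr_bracket P J B) (nr_carrier W) (nr_bracket Q K C)"
proof -
  have "- P = {}" using assms(3) by simp
  then have "P = UNIV" by blast
  then have P: "P = UNIV" "CARD('n) = r" using assms(2) by auto
  have Q: "Q = {}" "CARD('m) = r" using assms(4,5) by auto
  have bilU: "bilinear J" "bilinear B" and bilW: "bilinear K" "bilinear C"
    using assms(6,7)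
    by (simp_all add: minimal_admissible_module_def admissible_module_def clifford_module_def)
  obtain e :: "nat \<Rightarrow> 'n" where e: "bij_betw e {..<r} UNIV"
    using ex_bij_betw_nat_finite[of "UNIV :: 'n set"] P by (auto simp: atLeast0LessThan)
  obtain d :: "nat \<Rightarrow> 'm" where d: "bij_betw d {..<r} UNIV"
    using ex_bij_betw_nat_finite[of "UNIV :: 'm set"] Q by (auto simp: atLeast0LessThan)
  have formP: "pseudo_inner P z w = 1 * (z \<bullet> w)" for z w
    by (simp add: P pseudo_inner_def inner_vec_def)
  have formQ: "pseudo_inner Q z w = - 1 * (z \<bullet> w)" for z w
    by (simp add: Q pseudo_inner_def inner_vec_def)
  obtain x where x: "clifford_frame U B (coordinate_map e J) r 1 x"
    "U = span (clifford_frame.frame (coordinate_map e J) x ` ({..<r} \<times> UNIV))"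
    using minimal_admissible_frame[OF assms(6) formP _ e assms(1)] by auto
  obtain y where y: "clifford_frame W C (coordinate_map d K) r (- 1) y"
    "W = span (clifford_frame.frame (coordinate_map d K) y ` ({..<r} \<times> UNIV))"
    using minimal_admissible_frame[OF assms(7) formQ _ d assms(1)] by auto
  interpret X: clifford_frame U B "coordinate_map e J" r 1 x by (rule x)
  interpret Y: clifford_frame W C "coordinate_map d K" r "- 1" y by (rule y)
  \<comment> \<open>Both frames have the same index set. The map is not a similarity: the odd norms
    are \<open>B x x\<close> and \<open>- C y y\<close>, the even ones \<open>B x x\<close> and
    \<open>C y y\<close>.\<close>
  obtain f where f: "linear f" "\<And>p. p \<in> X.frame_index \<Longrightarrow> f (X.frame p) = Y.frame p" "bij_betw f U W"
  proof (rule orthogonal_bij[of X.frame_index B X.frame C Y.frame])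
    show "B (X.frame p) (X.frame p) \<noteq> 0" if "p \<in> X.frame_index" for p
      using X.B_frame[OF that that] X.x_norm by auto
    show "C (Y.frame p) (Y.frame p) \<noteq> 0" if "p \<in> X.frame_index" for p
      using Y.B_frame[OF that that] Y.x_norm by auto
  qed (use bilU bilW X.B_frame Y.B_frame that x(2) y(2) in auto)
  \<comment> \<open>The common structure constants are multiplied by \<open>B x x\<close> in one
    module and by \<open>C y y\<close> in the other; the minus sign is that of the negative definite
    form in \<open>nr_bracket_expand\<close>.\<close>
  define \<tau> where "\<tau> = - C y y / B x x"
  have \<tau>: "\<tau> \<noteq> 0" using X.x_norm Y.x_norm by (simp add: \<tau>_def)
  have key: "\<tau> * B (J (axis (e i) 1) u) v = - C (K (axis (d i) 1) (f u)) (f v)"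
    if i: "i < r" and uv: "u \<in> U" "v \<in> U" for i u v
  proof (rule bilinear_eq[where f = "\<lambda>u v. \<tau> * B (J (axis (e i) 1) u) v"
        and g = "\<lambda>u v. - C (K (axis (d i) 1) (f u)) (f v)"])
    show "bilinear (\<lambda>u v. \<tau> * B (J (axis (e i) 1) u) v)"
      using bilU unfolding bilinear_def linear_iff by (auto simp: algebra_simps)
    show "bilinear (\<lambda>u v. - C (K (axis (d i) 1) (f u)) (f v))"
      using bilW f(1) unfolding bilinear_def linear_iff by (auto simp: algebra_simps)
    show "U \<subseteq> span (X.frame ` X.frame_index)" "U \<subseteq> span (X.frame ` X.frame_index)"
      using x(2) by auto
    fix a b assume "a \<in> X.frame ` X.frame_index" "b \<in> X.frame ` X.frame_index"
    then obtain p q where p: "a = X.frame p" "p \<in> X.frame_index" and q: "b = X.frame q" "q \<in> X.frame_index"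
      by blast
    have "B (J (axis (e i) 1) a) b = B x x * structure_coeff r i p q"
      using X.B_J_frame[OF i p(2) q(2)] p(1) q(1) by (simp add: coordinate_map_def)
    moreover have "C (K (axis (d i) 1) (f a)) (f b) = C y y * structure_coeff r i p q"
      using Y.B_J_frame[OF i p(2) q(2)] f(2) p q by (simp add: coordinate_map_def)
    ultimately show "\<tau> * B (J (axis (e i) 1) a) b = - C (K (axis (d i) 1) (f a)) (f b)"
      using X.x_norm by (simp add: \<tau>_def)
  qed (use uv in auto)
  \<comment> \<open>The centres have different index types; \<phi> matches the coordinates that
    carry the same number under \<open>d\<close> and \<open>e\<close>.\<close>
  define \<phi> where "\<phi> = e \<circ> inv_into {..<r} d"
  have \<phi>: "bij \<phi>"
    unfolding \<phi>_def using bij_betw_trans[OF bij_betw_inv_into[OF d] e] .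
  have \<phi>_d: "\<phi> (d i) = e i" if "i < r" for i
    using d that by (simp add: \<phi>_def bij_betw_def inv_into_f_f)
  define g where "g c = (\<chi> m. \<tau> * c $ \<phi> m)" for c
  define F where "F v = (f (fst v), g (snd v))" for v
  have "linear g"
    by (intro linearI) (simp_all add: g_def vec_eq_iff algebra_simps)
  then have "linear F"
    using f(1) by (intro linearI) (simp_all add: F_def linear_add linear_cmul)
  moreover have "bij_betw F (nr_carrier U) (nr_carrier W)"
  proof -
    have "bij_betw g UNIV UNIV"
      by (rule bij_betw_byWitness[where f' = "\<lambda>c. \<chi> n. c $ inv \<phi> n / \<tau>"])
        (use \<tau> \<phi> in \<open>auto simp: g_def vec_eq_iff bij_is_inj bij_is_surj surj_f_inv_f\<close>)
    then have "bij_betw (map_prod f g) (U \<times> UNIV) (W \<times> UNIV)"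
      using f(3) by (intro bij_betw_map_prod)
    moreover have "F = map_prod f g" by (auto simp: F_def)
    ultimately show ?thesis by (simp add: nr_carrier_def)
  qed
  moreover have "F (nr_bracket P J B v w) = nr_bracket Q K C (F v) (F w)"
    if "v \<in> nr_carrier U" "w \<in> nr_carrier U" for v w
  proof -
    have vw: "fst v \<in> U" "fst w \<in> U" using that by (auto simp: nr_carrier_def)
    have "\<tau> * B (J (axis (\<phi> m) 1) (fst v)) (fst w) = - C (K (axis m 1) (f (fst v))) (f (fst w))" for m
    proof -
      have "m \<in> d ` {..<r}" using d by (simp add: bij_betw_def)
      then show ?thesis using key[OF _ vw] \<phi>_d by auto
    qed
    then show ?thesis
      unfolding nr_bracket_expand[OF bilU] nr_bracket_expand[OF bilW]
      by (simp add: F_def g_def P Q linear_0[OF f(1)])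
  qed
  ultimately show ?thesis unfolding lie_algebra_isomorphic_def by blast
qed

end
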